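(* Let $K\ge 1$. Suppose that $f(z)=h(z)+\overline{g(z)}=\sum_{n=0}^\infty a_n z^n+\overline{\sum_{n=1}^\infty b_n z^n}$ is a sense-preserving $K$-quasiconformal harmonic mapping of the unit disk $\mathbb{D}$, where $h$ satisfies $\mathrm{Re}\,h(z)\le 1$ in $\mathbb{D}$ and $h(0)=a_0$ is positive. Then $$a_0+\sum_{n=1}^\infty |a_n|r^n+\sum_{n=1}^\infty |b_n|r^n\le 1\quad\text{for } 0\le r\le \frac{K+1}{5K+1}.$$ The constant $(K+1)/(5K+1)$ is sharp, i.e. it cannot be replaced by a larger number: for every $r\in\left(\frac{K+1}{5K+1},1\right)$ there is such a mapping $f$ for which the inequality fails at $r$.
   Context: $\mathbb{D}=\{z\in\mathbb{C}:|z|<1\}$. A harmonic mapping in $\mathbb{D}$ is a complex-valued function $f$ with $\Delta f=0$; it is written $f=h+\overline{g}$ with $h,g$ analytic in $\mathbb{D}$ and $g(0)=0$, where $h(z)=\sum_{n\ge0}a_nz^n$ and $g(z)=\sum_{n\ge1}b_nz^n$. It is (locally univalent and) sense-preserving if its Jacobian $J_f=|h'|^2-|g'|^2$ is positive in $\mathbb{D}$; equivalently $h'\neq0$ and the dilatation $\omega_f=g'/h'$ satisfies $|\omega_f|<1$ in $\mathbb{D}$. A sense-preserving homeomorphism $f$ of $\mathbb{D}$ onto a domain $\Omega'$, belonging to $W^{1,2}_{loc}(\mathbb{D})$, is $K$-quasiconformal ($K\ge1$) if $\frac{|f_z|+|f_{\bar z}|}{|f_z|-|f_{\bar z}|}\le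 K$ in $\mathbb{D}$; for harmonic $f=h+\overline g$ this means $|\omega_f(z)|\le k=\frac{K-1}{K+1}$ for $z\in\mathbb{D}$. *)

theory Defs
  imports "HOL-Complex_Analysis.Complex_Analysis"
begin

definition pd :: "complex \<Rightarrow> (complex \<Rightarrow> 'a::real_normed_vector) \<Rightarrow> complex \<Rightarrow> 'a" where
  "pd v f z = frechet_derivative f (at z) v"

text \<open>With \<open>z = x + \<i>y\<close>, the partial derivatives in \<open>x\<close> and \<open>y\<close> are \<open>pd 1\<close> and
  \<open>pd \<i>\<close>. The set \<open>U\<close> is meant to be open throughout.\<close>

primrec Ck_on :: "nat \<Rightarrow> complex set \<Rightarrow> (complex \<Rightarrow> 'a::real_normed_vector) \<Rightarrow> bool" where
  "Ck_on 0 U f \<longleftrightarrow> continuous_on U f"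
| "Ck_on (Suc k) U f \<longleftrightarrow>
     (\<forall>z\<in>U. f differentiable (at z)) \<and> Ck_on k U (pd 1 f) \<and> Ck_on k U (pd \<i> f)"

definition harmonic_on :: "complex set \<Rightarrow> (complex \<Rightarrow> complex) \<Rightarrow> bool" where
  "harmonic_on U f \<longleftrightarrow>
     Ck_on 2 U f \<and> (\<forall>z\<in>U. pd 1 (pd 1 f) z + pd \<i> (pd \<i> f) z = 0)"

definition dz :: "(complex \<Rightarrow> complex) \<Rightarrow> complex \<Rightarrow> complex" where
  "dz f z = (pd 1 f z - \<i> * pd \<i> f z) / 2"

definition dzbar :: "(complex \<Rightarrow> complex) \<Rightarrow> complex \<Rightarrow> complex" where
  "dzbar f z = (pd 1 f z + \<i> * pd \<i> f z) / 2"

definition jacobian :: "(complex \<Rightarrow> complex) \<Rightarrow> complex \<Rightarrow> real" where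
  "jacobian f z = (cmod (dz f z))\<^sup>2 - (cmod (dzbar f z))\<^sup>2"

definition sense_preserving_on :: "complex set \<Rightarrow> (complex \<Rightarrow> complex) \<Rightarrow> bool" where
  "sense_preserving_on U f \<longleftrightarrow> (\<forall>z\<in>U. f differentiable (at z) \<and> jacobian f z > 0)"

definition test_function :: "complex set \<Rightarrow> (complex \<Rightarrow> real) \<Rightarrow> bool" where
  "test_function U \<phi> \<longleftrightarrow>
     (\<forall>k. Ck_on k UNIV \<phi>) \<and>
     compact (closure {z. \<phi> z \<noteq> 0}) \<and> closure {z. \<phi> z \<noteq> 0} \<subseteq> U"

definition L2_loc :: "complex set \<Rightarrow> (complex \<Rightarrow> complex) \<Rightarrow> bool" where
  "L2_loc U f \<longleftrightarrow>
     set_borel_measurable lebesgue U f \<and>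
     (\<forall>C. compact C \<and> C \<subseteq> U \<longrightarrow> set_integrable lebesgue C (\<lambda>z. (cmod (f z))\<^sup>2))"

definition weak_pd :: "complex set \<Rightarrow> complex \<Rightarrow> (complex \<Rightarrow> complex) \<Rightarrow> (complex \<Rightarrow> complex) \<Rightarrow> bool"
  where
  "weak_pd U v f p \<longleftrightarrow>
     (\<forall>\<phi>. test_function U \<phi> \<longrightarrow>
        (LINT z:U|lebesgue. pd v \<phi> z *\<^sub>R f z) = - (LINT z:U|lebesgue. \<phi> z *\<^sub>R p z))"

definition W12_loc :: "complex set \<Rightarrow> (complex \<Rightarrow> complex) \<Rightarrow> bool" where
  "W12_loc U f \<longleftrightarrow>
     L2_loc U f \<and>
     (\<exists>p q. L2_loc U p \<and> L2_loc U q \<and> weak_pd U 1 f p \<and> weak_pd U \<i> f q)"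

text \<open>Quasiconformality for maps that are differentiable with positive Jacobian at every point, as
  sense-preserving harmonic homeomorphisms are. The distortion bound is then required at every
  point, and positivity of the Jacobian makes its denominator positive.\<close>

definition quasiconformal_on :: "real \<Rightarrow> complex set \<Rightarrow> (complex \<Rightarrow> complex) \<Rightarrow> bool" where
  "quasiconformal_on K U f \<longleftrightarrow>
     (\<exists>\<Omega> f'. open \<Omega> \<and> connected \<Omega> \<and> homeomorphism U \<Omega> f f') \<and>
     sense_preserving_on U f \<and> W12_loc U f \<and>
     (\<forall>z\<in>U. (cmod (dz f z) + cmod (dzbar f z)) / (cmod (dz f z) - cmod (dzbar f z)) \<le> K)"

definition harmonic_series ::
    "(complex \<Rightarrow> complex) \<Rightarrow> (complex \<Rightarrow> complex) \<Rightarrow> (complex \<Rightarrow> complex) \<Rightarrow>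
     (nat \<Rightarrow> complex) \<Rightarrow> (nat \<Rightarrow> complex) \<Rightarrow> bool" where
  "harmonic_series f h g a b \<longleftrightarrow>
     harmonic_on (ball 0 1) f \<and>
     h holomorphic_on ball 0 1 \<and> g holomorphic_on ball 0 1 \<and>
     (\<forall>z\<in>ball 0 1. f z = h z + cnj (g z) \<and>
        (\<lambda>n. a n * z ^ n) sums h z \<and> (\<lambda>n. b (Suc n) * z ^ Suc n) sums g z)"

text \<open>The value \<open>b 0\<close> is irrelevant; the series of \<open>g\<close> starts at index 1, so \<open>g 0 = 0\<close>.\<close>

definition admissible ::
    "real \<Rightarrow> (complex \<Rightarrow> complex) \<Rightarrow> (complex \<Rightarrow> complex) \<Rightarrow> (complex \<Rightarrow> complex) \<Rightarrow>
     (nat \<Rightarrow> complex) \<Rightarrow> (nat \<Rightarrow> complex) \<Rightarrow> bool" where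
  "admissible K f h g a b \<longleftrightarrow>
     harmonic_series f h g a b \<and>
     quasiconformal_on K (ball 0 1) f \<and>
     (\<forall>z\<in>ball 0 1. Re (h z) \<le> 1) \<and>
     h 0 = a 0 \<and> Im (a 0) = 0 \<and> Re (a 0) > 0"

end

theory Submission
  imports Defs
begin

text \<open>Put \<open>k = (K - 1) / (K + 1)\<close>. Since \<open>1 - h\<close> has nonnegative real part, Caratheodory's inequality
\<open>norm_coeff_le_if_Re_nonneg\<close> gives \<open>cmod (a n) \<le> 2 (1 - a\<^sub>0)\<close> for \<open>n > 0\<close>, so the series of
\<open>h\<close> without its constant term is at most \<open>2 (1 - a\<^sub>0) r / (1 - r)\<close>.

Quasiconformality says \<open>cmod g' \<le> k cmod h'\<close>. The quotient \<open>g' / h'\<close> is thus a holomorphic function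
bounded by \<open>k\<close>, and by Bohr's inequality, itself a consequence of Caratheodory's, its majorant
series is at most \<open>k\<close> for \<open>r \<le> 1 / 3\<close>. Hence the series of \<open>g\<close> is at most \<open>k\<close> times that of \<open>h\<close>
(\<open>majorant_le_if_deriv_dominated\<close>). Together,
\<open>a\<^sub>0 + (1 + k) 2 (1 - a\<^sub>0) r / (1 - r)\<close> bounds the whole sum, and this is at most 1 exactly when
\<open>a\<^sub>0 = 1\<close> or \<open>r \<le> (K + 1) / (5 K + 1)\<close>, a radius that does not exceed \<open>1 / 3\<close>.

For sharpness the coefficient bounds have to be equalities. The half plane map
\<open>h z = 1 / 2 - z / (1 - z)\<close> has \<open>a\<^sub>0 = 1 / 2\<close> and all other coefficients \<open>-1\<close>, and
\<open>g = k (h - 1 / 2)\<close> makes the dilatation constant. Then \<open>h + cnj g\<close> is an affine image of a conformal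
map, hence a homeomorphism onto a half plane. Its membership in the local Sobolev space comes from
integration by parts for continuously differentiable functions (\<open>weak_pd_if_classical\<close>), which
rests on the translation invariance of Lebesgue measure.\<close>

section \<open>Coefficients of functions with nonnegative real part\<close>

lemma eventually_in_unit_disc: "eventually (\<lambda>z::complex. z \<in> ball 0 1) (nhds 0)"
  by (rule eventually_nhds_in_open) auto

text \<open>This is Cauchy's formula for the derivatives at the origin, written as an integral over the
parameter of the circle, so that the integrand may be conjugated and its real part may be taken.\<close>

lemma has_integral_circle_power_coeff:
  fixes F :: "complex \<Rightarrow> complex" and \<rho> :: real
  assumes holo: "F holomorphic_on ball 0 1" and \<rho>: "0 < \<rho>" "\<rho> < 1"
  shows "((\<lambda>t. F (\<rho> * exp (2 * of_real pi * \<i> * of_real t)) * exp (- (2 * of_real pi * \<i> * of_real t)) ^ n)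
           has_integral (deriv ^^ n) F 0 / fact n * \<rho> ^ n) {0..1}"
proof -
  have sub: "cball 0 \<rho> \<subseteq> ball (0::complex) 1" using \<rho> by auto
  have "((\<lambda>u. F u / (u - 0) ^ Suc n) has_contour_integral
           ((2 * pi * \<i>) / fact n * (deriv ^^ n) F 0)) (circlepath 0 \<rho>)"
    by (rule Cauchy_has_contour_integral_higher_derivative_circlepath)
       (use sub holo \<rho> in \<open>auto intro!: holomorphic_on_imp_continuous_on intro: holomorphic_on_subset\<close>)
  hence "((\<lambda>t. F (circlepath 0 \<rho> t) / circlepath 0 \<rho> t ^ Suc n * vector_derivative (circlepath 0 \<rho>) (at t within {0..1}))
            has_integral ((2 * pi * \<i>) / fact n * (deriv ^^ n) F 0)) {0..1}"
    by (simp add: has_contour_integral_def)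
  hence "((\<lambda>t. (\<rho> ^ n / (2 * pi * \<i>)) * (F (circlepath 0 \<rho> t) / circlepath 0 \<rho> t ^ Suc n * vector_derivative (circlepath 0 \<rho>) (at t within {0..1})))
            has_integral (\<rho> ^ n / (2 * pi * \<i>)) * ((2 * pi * \<i>) / fact n * (deriv ^^ n) F 0)) {0..1}"
    by (rule has_integral_mult_right)
  also have "(\<rho> ^ n / (2 * pi * \<i>)) * ((2 * pi * \<i>) / fact n * (deriv ^^ n) F 0)
      = (deriv ^^ n) F 0 / fact n * \<rho> ^ n"
  proof -
    have cancel: "(x / w) * (w / y * d) = d / y * x" if "w \<noteq> 0" for w x y d :: complex
      using that by simp
    show ?thesis by (rule cancel) simp
  qed
  finally show ?thesis
  proof (rule has_integral_eq[rotated])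
    fix t :: real assume t: "t \<in> {0..1}"
    define e where "e = exp (2 * of_real pi * \<i> * of_real t :: complex)"
    have e: "e \<noteq> 0" by (simp add: e_def)
    have c: "circlepath 0 \<rho> t = \<rho> * e" by (simp add: circlepath e_def)
    have vd: "vector_derivative (circlepath 0 \<rho>) (at t within {0..1}) = 2 * pi * \<i> * \<rho> * e"
      using t by (simp add: vector_derivative_circlepath01 e_def)
    have "\<rho> ^ n / (2 * pi * \<i>) * (F (\<rho> * e) / (\<rho> * e) ^ Suc n * (2 * pi * \<i> * \<rho> * e))
       = F (\<rho> * e) * (1 / e) ^ n"
      using e \<rho> by (simp add: field_simps)
    thus "\<rho> ^ n / (2 * pi * \<i>) * (F (circlepath 0 \<rho> t) / circlepath 0 \<rho> t ^ Suc n * vector_derivative (circlepath 0 \<rho>) (at t within {0..1})) =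
       F (\<rho> * exp (2 * of_real pi * \<i> * of_real t)) * exp (- (2 * of_real pi * \<i> * of_real t)) ^ n"
      unfolding c vd exp_minus e_def by (simp add: inverse_eq_divide)
  qed
qed

text \<open>Write \<open>e t = exp (2 \<pi> \<i> t)\<close> and let \<open>c\<^sub>n\<close> be the coefficients of \<open>F\<close>. On the circle of radius \<open>\<rho>\<close>
the mean of \<open>F \<cdot> cnj e\<^sup>n\<close> is \<open>c\<^sub>n \<rho>\<^sup>n\<close>, whereas the mean of \<open>F \<cdot> e\<^sup>n\<close> vanishes. Adding the
conjugate of the second to the first shows that \<open>c\<^sub>n \<rho>\<^sup>n\<close> is the mean of
\<open>2 Re F \<cdot> cnj e\<^sup>n\<close>. Since \<open>Re F\<close> is nonnegative, this is at most the mean of \<open>2 Re F\<close>, which is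
\<open>2 Re c\<^sub>0\<close>; the bound follows as \<open>\<rho>\<close> tends to 1. This is Caratheodory's inequality.\<close>

lemma norm_coeff_le_if_Re_nonneg:
  assumes holo: "F holomorphic_on ball 0 1" and pos: "\<And>z. z \<in> ball 0 1 \<Longrightarrow> Re (F z) \<ge> 0"
    and fps: "F has_fps_expansion P" and n: "n > 0"
  shows "cmod (fps_nth P n) \<le> 2 * Re (fps_nth P 0)"
proof -
  have P: "fps_nth P m = (deriv ^^ m) F 0 / fact m" for m
    by (rule fps_nth_fps_expansion[OF fps])
  have bound: "cmod (fps_nth P n) * \<rho> ^ n \<le> 2 * Re (fps_nth P 0)" if \<rho>: "0 < \<rho>" "\<rho> < 1" for \<rho> :: real
  proof -
    define e where "e t = exp (2 * of_real pi * \<i> * of_real t :: complex)" for t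
    have norm_e: "cmod (e t) = 1" for t by (simp add: e_def)
    have inv_e: "exp (- (2 * of_real pi * \<i> * of_real t)) = cnj (e t)" for t
      by (simp add: e_def exp_cnj)
    have e_cnj: "e t * cnj (e t) = 1" for t
      using complex_norm_square[of "e t"] norm_e[of t] by simp
    have 1: "((\<lambda>t. F (\<rho> * e t) * cnj (e t) ^ n) has_integral fps_nth P n * \<rho> ^ n) {0..1}"
      using has_integral_circle_power_coeff[OF holo \<rho>, of n] by (simp add: inv_e P flip: e_def)
    have 0: "((\<lambda>t. F (\<rho> * e t)) has_integral fps_nth P 0) {0..1}"
      using has_integral_circle_power_coeff[OF holo \<rho>, of 0] by (simp add: P flip: e_def)
    \<comment> \<open>The mean value property of \<open>u \<mapsto> F u * u ^ n\<close>, which vanishes at 0.\<close>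
    have "((\<lambda>t. F (\<rho> * e t) * (\<rho> * e t) ^ n) has_integral 0) {0..1}"
      using has_integral_circle_power_coeff[of "\<lambda>u. F u * u ^ n", OF _ \<rho>, of 0] holo n
      by (simp add: holomorphic_intros zero_power flip: e_def)
    from has_integral_mult_right[OF this, of "1 / \<rho> ^ n"]
    have 2: "((\<lambda>t. F (\<rho> * e t) * e t ^ n) has_integral 0) {0..1}"
      using \<rho> by (simp add: power_mult_distrib)
    have "((\<lambda>t. cnj (F (\<rho> * e t) * e t ^ n)) has_integral 0) {0..1}"
      using 2 by (simp only: has_integral_cnj[of "\<lambda>t. F (\<rho> * e t) * e t ^ n" 0, unfolded o_def complex_cnj_zero])
    from has_integral_add[OF 1 this]
    have 3: "((\<lambda>t. of_real (2 * Re (F (\<rho> * e t))) * cnj (e t) ^ n) has_integral fps_nth P n * \<rho> ^ n) {0..1}"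
      by (simp add: complex_add_cnj flip: distrib_right)
    have 4: "((\<lambda>t. 2 * Re (F (\<rho> * e t))) has_integral 2 * Re (fps_nth P 0)) {0..1}"
      using has_integral_mult_right[OF has_integral_Re[OF 0], of 2] .
    have "cmod (of_real (2 * Re (F (\<rho> * e t))) * cnj (e t) ^ n) \<le> 2 * Re (F (\<rho> * e t))" for t
    proof -
      have "\<rho> * e t \<in> ball 0 1" using \<rho> norm_e by (simp add: norm_mult)
      thus ?thesis using pos norm_e by (simp add: norm_mult norm_power)
    qed
    hence "cmod (integral {0..1} (\<lambda>t. of_real (2 * Re (F (\<rho> * e t))) * cnj (e t) ^ n))
        \<le> integral {0..1} (\<lambda>t. 2 * Re (F (\<rho> * e t)))"
      using 3 4 by (intro integral_norm_bound_integral) (blast intro: has_integral_integrable)+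
    thus ?thesis
      using \<rho> unfolding integral_unique[OF 3] integral_unique[OF 4] by (simp add: norm_mult norm_power)
  qed
  have "((\<lambda>\<rho>. cmod (fps_nth P n) * \<rho> ^ n) \<longlongrightarrow> cmod (fps_nth P n) * 1 ^ n) (at_left 1)"
    by (intro tendsto_intros)
  moreover have "eventually (\<lambda>\<rho>. cmod (fps_nth P n) * \<rho> ^ n \<le> 2 * Re (fps_nth P 0)) (at_left 1)"
    using eventually_at_left_real[OF zero_less_one] by eventually_elim (use bound in auto)
  ultimately show ?thesis
    by (intro tendsto_upperbound[where F = "at_left (1::real)"]) auto
qed

lemma has_fps_expansion_if_sums:
  fixes c :: "nat \<Rightarrow> complex"
  assumes "\<And>z. z \<in> ball 0 1 \<Longrightarrow> (\<lambda>n. c n * z ^ n) sums F z"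
  shows "F has_fps_expansion Abs_fps c"
proof -
  have "conv_radius c \<ge> norm (1/2 :: complex)"
    using assms[of "1/2"] by (intro conv_radius_geI) (auto simp: sums_iff)
  hence "fps_conv_radius (Abs_fps c) > 0"
    unfolding fps_conv_radius_def by (auto intro: less_le_trans[rotated])
  moreover have "eventually (\<lambda>z. eval_fps (Abs_fps c) z = F z) (nhds 0)"
    using eventually_in_unit_disc by eventually_elim (use assms in \<open>auto simp: eval_fps_def sums_iff\<close>)
  ultimately show ?thesis by (simp add: has_fps_expansion_def)
qed

section \<open>Majorant series and domination of derivatives\<close>

lemma geometric_tail_majorant:
  fixes c :: "nat \<Rightarrow> complex"
  assumes c: "\<And>n. n > 0 \<Longrightarrow> cmod (c n) \<le> M" and r: "0 \<le> r" "r < 1"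
  shows "summable (\<lambda>n. cmod (c (Suc n)) * r ^ Suc n)"
    and "(\<Sum>n. cmod (c (Suc n)) * r ^ Suc n) \<le> M * (r / (1 - r))"
proof -
  have geo: "(\<lambda>n. M * r * r ^ n) sums (M * r * (1 / (1 - r)))"
    using r by (intro sums_mult geometric_sums) auto
  have le: "cmod (c (Suc n)) * r ^ Suc n \<le> M * r * r ^ n" for n
    using mult_right_mono[OF c[of "Suc n"], of "r ^ Suc n"] r by (simp add: mult_ac)
  show s: "summable (\<lambda>n. cmod (c (Suc n)) * r ^ Suc n)"
    by (rule summable_comparison_test'[OF sums_summable[OF geo]]) (use le r in \<open>auto simp: norm_mult\<close>)
  show "(\<Sum>n. cmod (c (Suc n)) * r ^ Suc n) \<le> M * (r / (1 - r))"
    using suminf_le[OF le s sums_summable[OF geo]] sums_unique[OF geo] by simp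
qed

text \<open>Choose a unimodular \<open>u\<close> that makes \<open>u * \<phi> 0\<close> real and nonnegative. The function \<open>k - u * \<phi>\<close> has
nonnegative real part, so Caratheodory's inequality bounds the coefficients of \<open>\<phi>\<close> of positive
index by \<open>2 * (k - cmod (\<phi> 0))\<close>, and a geometric series does the rest.\<close>

lemma bohr_inequality:
  assumes holo: "\<phi> holomorphic_on ball 0 1" and le: "\<And>z. z \<in> ball 0 1 \<Longrightarrow> cmod (\<phi> z) \<le> k"
    and fps: "\<phi> has_fps_expansion P" and r: "0 \<le> r" "r \<le> 1 / 3"
  shows "summable (\<lambda>n. cmod (fps_nth P n) * r ^ n)" "(\<Sum>n. cmod (fps_nth P n) * r ^ n) \<le> k"
proof -
  define c where "c = fps_nth P 0"
  have \<phi>0: "\<phi> 0 = c" using fps_nth_fps_expansion[OF fps, of 0] by (simp add: c_def)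
  have ck: "cmod c \<le> k" using le[of 0] \<phi>0 by simp
  obtain u where u: "cmod u = 1" "u * c = cmod c"
  proof (cases "c = 0")
    case True
    thus ?thesis using that[of 1] by simp
  next
    case False
    show ?thesis
      by (rule that[of "cnj c / cmod c"])
         (use False complex_norm_square[of c] in \<open>auto simp: norm_divide power2_eq_square field_simps\<close>)
  qed
  have coeff: "cmod (fps_nth P n) \<le> 2 * (k - cmod c)" if "n > 0" for n
  proof -
    have "(\<lambda>z. of_real k - u * \<phi> z) has_fps_expansion (fps_const (of_real k) - fps_const u * P)"
      by (intro fps_expansion_intros fps)
    moreover have "Re (of_real k - u * \<phi> z) \<ge> 0" if "z \<in> ball 0 1" for z
      using complex_Re_le_cmod[of "u * \<phi> z"] le[OF that] u by (simp add: norm_mult)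
    ultimately have "cmod (fps_nth (fps_const (of_real k) - fps_const u * P) n)
          \<le> 2 * Re (fps_nth (fps_const (of_real k) - fps_const u * P) 0)"
      using holo \<open>n > 0\<close> by (intro norm_coeff_le_if_Re_nonneg[where F = "\<lambda>z. of_real k - u * \<phi> z"])
        (auto intro!: holomorphic_intros)
    thus ?thesis using u \<open>n > 0\<close> by (simp add: norm_mult flip: c_def)
  qed
  have r1: "r < 1" using r by simp
  have tail: "summable (\<lambda>n. cmod (fps_nth P (Suc n)) * r ^ Suc n)"
      "(\<Sum>n. cmod (fps_nth P (Suc n)) * r ^ Suc n) \<le> 2 * (k - cmod c) * (r / (1 - r))"
    using geometric_tail_majorant[of "fps_nth P" "2 * (k - cmod c)" r] coeff r(1) r1 by auto
  show summable: "summable (\<lambda>n. cmod (fps_nth P n) * r ^ n)"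
    using tail(1) by (subst (asm) summable_Suc_iff)
  have "(\<Sum>n. cmod (fps_nth P n) * r ^ n) = cmod c + (\<Sum>n. cmod (fps_nth P (Suc n)) * r ^ Suc n)"
    using suminf_split_head[OF summable] by (simp add: c_def)
  also have "(\<Sum>n. cmod (fps_nth P (Suc n)) * r ^ Suc n) \<le> 2 * (k - cmod c) * (r / (1 - r))"
    by (rule tail(2))
  also have "\<dots> \<le> (k - cmod c) * 1"
  proof -
    \<comment> \<open>This is where the radius \<open>1 / 3\<close> enters: it solves \<open>2 * r / (1 - r) = 1\<close>.\<close>
    have "2 * (r / (1 - r)) \<le> 1" using r by (simp add: field_simps)
    from mult_left_mono[OF this, of "k - cmod c"] show ?thesis using ck by (simp add: mult_ac)
  qed
  finally show "(\<Sum>n. cmod (fps_nth P n) * r ^ n) \<le> k" by simp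
qed

text \<open>The quotient \<open>\<phi> = g' / h'\<close> is bounded by \<open>k\<close>, so Bohr's inequality bounds its majorant series by \<open>k\<close>
up to the radius \<open>1 / 3\<close>. Comparing coefficients in \<open>g' = \<phi> h'\<close> gives
\<open>(n + 1) b\<^sub>n\<^sub>+\<^sub>1 = (\<Sum>i\<le>n. \<phi>\<^sub>i (n - i + 1) a\<^sub>n\<^sub>-\<^sub>i\<^sub>+\<^sub>1)\<close>. The weights \<open>(n - i + 1) / (n + 1)\<close> are at most 1, so the
majorant series of \<open>g\<close> is dominated by the Cauchy product of those of \<open>\<phi>\<close> and \<open>h\<close>, without any
integration.\<close>

lemma majorant_le_if_deriv_dominated:
  assumes h: "h holomorphic_on ball 0 1" and g: "g holomorphic_on ball 0 1"
    and nz: "\<And>z. z \<in> ball 0 1 \<Longrightarrow> deriv h z \<noteq> 0"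
    and dom: "\<And>z. z \<in> ball 0 1 \<Longrightarrow> cmod (deriv g z) \<le> k * cmod (deriv h z)"
    and H: "h has_fps_expansion H" and G: "g has_fps_expansion G"
    and r: "0 \<le> r" "r \<le> 1 / 3"
    and summ: "summable (\<lambda>n. cmod (fps_nth H (Suc n)) * r ^ Suc n)"
  shows "summable (\<lambda>n. cmod (fps_nth G (Suc n)) * r ^ Suc n)"
    "(\<Sum>n. cmod (fps_nth G (Suc n)) * r ^ Suc n) \<le> k * (\<Sum>n. cmod (fps_nth H (Suc n)) * r ^ Suc n)"
proof -
  define \<phi> where "\<phi> z = deriv g z / deriv h z" for z
  define P where "P = fps_expansion \<phi> 0"
  have holo: "\<phi> holomorphic_on ball 0 1"
    unfolding \<phi>_def by (intro holomorphic_intros h g nz) auto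
  have P: "\<phi> has_fps_expansion P"
    unfolding P_def by (rule has_fps_expansion_fps_expansion[OF _ _ holo]) auto
  have le: "cmod (\<phi> z) \<le> k" if "z \<in> ball 0 1" for z
    using dom[OF that] nz[OF that] by (simp add: \<phi>_def norm_divide field_simps)
  note bohr = bohr_inequality[OF holo le P r]
  have "(\<lambda>z. \<phi> z * deriv h z) has_fps_expansion P * fps_deriv H"
    by (intro fps_expansion_intros P H)
  moreover have "eventually (\<lambda>z. \<phi> z * deriv h z = deriv g z) (nhds 0)"
    using eventually_in_unit_disc by eventually_elim (use nz in \<open>auto simp: \<phi>_def\<close>)
  ultimately have "deriv g has_fps_expansion P * fps_deriv H"
    by (subst has_fps_expansion_cong[OF _ refl, of _ "\<lambda>z. \<phi> z * deriv h z"]) (auto elim: eventually_mono)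
  hence eq: "fps_deriv G = P * fps_deriv H"
    using has_fps_expansion_deriv[OF G] fps_expansion_unique_complex by blast
  define p where "p i = cmod (fps_nth P i) * r ^ i" for i
  define q where "q i = cmod (fps_nth H (Suc i)) * r ^ Suc i" for i
  have p0: "p i \<ge> 0" and q0: "q i \<ge> 0" for i using r by (auto simp: p_def q_def)
  have coeff: "cmod (fps_nth G (Suc n)) * r ^ Suc n \<le> (\<Sum>i\<le>n. p i * q (n - i))" for n
  proof -
    have "of_nat (Suc n) * fps_nth G (Suc n) = (\<Sum>i\<le>n. fps_nth P i * (of_nat (Suc (n - i)) * fps_nth H (Suc (n - i))))"
      using arg_cong[OF eq, of "\<lambda>F. fps_nth F n"] by (simp add: fps_mult_nth atMost_atLeast0)
    hence "real (Suc n) * cmod (fps_nth G (Suc n)) = cmod (\<Sum>i\<le>n. fps_nth P i * (of_nat (Suc (n - i)) * fps_nth H (Suc (n - i))))"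
      by (metis norm_mult norm_of_nat)
    also have "\<dots> \<le> (\<Sum>i\<le>n. cmod (fps_nth P i) * (real (Suc (n - i)) * cmod (fps_nth H (Suc (n - i)))))"
      by (rule order_trans[OF norm_sum]) (simp add: norm_mult del: of_nat_Suc)
    also have "\<dots> \<le> (\<Sum>i\<le>n. cmod (fps_nth P i) * (real (Suc n) * cmod (fps_nth H (Suc (n - i)))))"
      by (intro sum_mono mult_left_mono mult_right_mono) auto
    also have "\<dots> = real (Suc n) * (\<Sum>i\<le>n. cmod (fps_nth P i) * cmod (fps_nth H (Suc (n - i))))"
      by (simp add: sum_distrib_left mult_ac)
    finally have "cmod (fps_nth G (Suc n)) \<le> (\<Sum>i\<le>n. cmod (fps_nth P i) * cmod (fps_nth H (Suc (n - i))))"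
      by (simp del: of_nat_Suc)
    hence "cmod (fps_nth G (Suc n)) * r ^ Suc n \<le> (\<Sum>i\<le>n. cmod (fps_nth P i) * cmod (fps_nth H (Suc (n - i)))) * r ^ Suc n"
      using r by (intro mult_right_mono) auto
    also have "\<dots> = (\<Sum>i\<le>n. p i * q (n - i))"
      unfolding sum_distrib_right
    proof (rule sum.cong)
      fix i assume "i \<in> {..n}"
      hence "r ^ Suc n = r ^ i * r ^ Suc (n - i)" by (simp flip: power_add)
      thus "cmod (fps_nth P i) * cmod (fps_nth H (Suc (n - i))) * r ^ Suc n = p i * q (n - i)"
        by (simp add: p_def q_def)
    qed simp
    finally show ?thesis .
  qed
  have sp: "summable p" using bohr(1) by (simp add: p_def[abs_def])
  have sq: "summable q" using summ by (simp add: q_def[abs_def])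
  have prod: "(\<lambda>n. \<Sum>i\<le>n. p i * q (n - i)) sums ((\<Sum>n. p n) * (\<Sum>n. q n))"
    by (rule Cauchy_product_sums) (use sp sq p0 q0 in auto)
  show s: "summable (\<lambda>n. cmod (fps_nth G (Suc n)) * r ^ Suc n)"
    by (rule summable_comparison_test'[OF sums_summable[OF prod]])
       (use coeff r in \<open>auto simp: norm_mult norm_power\<close>)
  have "(\<Sum>n. cmod (fps_nth G (Suc n)) * r ^ Suc n) \<le> (\<Sum>n. p n) * (\<Sum>n. q n)"
    using suminf_le[OF coeff s sums_summable[OF prod]] sums_unique[OF prod] by simp
  also have "\<dots> \<le> k * (\<Sum>n. q n)"
    using bohr(2) q0 sq by (intro mult_right_mono suminf_nonneg) (auto simp: p_def)
  finally show "(\<Sum>n. cmod (fps_nth G (Suc n)) * r ^ Suc n) \<le> k * (\<Sum>n. cmod (fps_nth H (Suc n)) * r ^ Suc n)"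
    by (simp add: q_def)
qed
section \<open>Derivatives of a holomorphic plus an antiholomorphic function\<close>

lemma has_derivative_cong_open:
  assumes "open U" "z \<in> U" "\<And>w. w \<in> U \<Longrightarrow> f w = f' w"
  shows "(f has_derivative D) (at z) \<longleftrightarrow> (f' has_derivative D) (at z)"
  using assms by (auto intro: has_derivative_transform_within_open)

lemma pd_cong:
  assumes "open U" "z \<in> U" "\<And>w. w \<in> U \<Longrightarrow> f w = f' w"
  shows "pd v f z = pd v f' z"
  by (simp add: pd_def frechet_derivative_def has_derivative_cong_open[OF assms])

lemma differentiable_cong_open:
  assumes "open U" "z \<in> U" "\<And>w. w \<in> U \<Longrightarrow> f w = f' w"
  shows "f differentiable (at z) \<longleftrightarrow> f' differentiable (at z)"
  by (simp add: differentiable_def has_derivative_cong_open[OF assms])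

lemma Ck_on_cong:
  assumes "open U" "\<And>z. z \<in> U \<Longrightarrow> f z = f' z"
  shows "Ck_on k U f \<longleftrightarrow> Ck_on k U f'"
  using assms(2)
proof (induction k arbitrary: f f')
  case 0
  thus ?case by (simp cong: continuous_on_cong)
next
  case (Suc k)
  have "Ck_on k U (pd v f) \<longleftrightarrow> Ck_on k U (pd v f')" for v
    by (intro Suc.IH pd_cong[OF assms(1)] Suc.prems)
  moreover have "(\<forall>z\<in>U. f differentiable (at z)) \<longleftrightarrow> (\<forall>z\<in>U. f' differentiable (at z))"
    using differentiable_cong_open[OF assms(1)] Suc.prems by blast
  ultimately show ?case by simp
qed

lemma has_derivative_add_cnj:
  assumes "h holomorphic_on U" "g holomorphic_on U" "open U" "z \<in> U"
  shows "((\<lambda>z. h z + cnj (g z)) has_derivative (\<lambda>v. deriv h z * v + cnj (deriv g z * v))) (at z)"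
proof -
  have "(h has_derivative (\<lambda>v. deriv h z * v)) (at z)" "(g has_derivative (\<lambda>v. deriv g z * v)) (at z)"
    using holomorphic_derivI[OF assms(1,3,4)] holomorphic_derivI[OF assms(2,3,4)]
    by (simp_all add: has_field_derivative_def)
  thus ?thesis by (intro has_derivative_add has_derivative_cnj)
qed

lemma pd_add_cnj:
  assumes "h holomorphic_on U" "g holomorphic_on U" "open U" "z \<in> U"
  shows "pd v (\<lambda>z. h z + cnj (g z)) z = deriv h z * v + cnj (deriv g z * v)"
  by (simp add: pd_def flip: frechet_derivative_at[OF has_derivative_add_cnj[OF assms]])

text \<open>A directional derivative of such a sum is again such a sum, so that the induction runs over all
pairs of holomorphic functions at once.\<close>

lemma Ck_on_add_cnj:
  assumes "h holomorphic_on U" "g holomorphic_on U" "open U"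
  shows "Ck_on k U (\<lambda>z. h z + cnj (g z))"
  using assms(1,2)
proof (induction k arbitrary: h g)
  case 0
  hence "continuous_on U h" "continuous_on U g"
    by (auto intro: holomorphic_on_imp_continuous_on)
  thus ?case by (simp add: continuous_on_add continuous_on_cnj)
next
  case (Suc k)
  have "Ck_on k U (pd v (\<lambda>z. h z + cnj (g z)))" for v
  proof -
    have "Ck_on k U (\<lambda>z. deriv h z * v + cnj (deriv g z * v))"
      using Suc.prems assms(3) by (intro Suc.IH holomorphic_intros)
    moreover have "Ck_on k U (pd v (\<lambda>z. h z + cnj (g z))) \<longleftrightarrow> Ck_on k U (\<lambda>z. deriv h z * v + cnj (deriv g z * v))"
      by (rule Ck_on_cong[OF assms(3)]) (rule pd_add_cnj[OF Suc.prems assms(3)])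
    ultimately show ?thesis by simp
  qed
  thus ?case
    using has_derivative_add_cnj[OF Suc.prems assms(3)] by (auto simp: differentiable_def)
qed

lemma harmonic_on_add_cnj:
  assumes h: "h holomorphic_on U" and g: "g holomorphic_on U" and U: "open U"
  shows "harmonic_on U (\<lambda>z. h z + cnj (g z))"
proof -
  have twice: "pd v (pd v (\<lambda>z. h z + cnj (g z))) z
      = deriv (deriv h) z * v * v + cnj (deriv (deriv g) z * v * v)" if z: "z \<in> U" for v z
  proof -
    have "pd v (pd v (\<lambda>z. h z + cnj (g z))) z = pd v (\<lambda>z. deriv h z * v + cnj (deriv g z * v)) z"
      by (rule pd_cong[OF U z pd_add_cnj[OF h g U]])
    also have "\<dots> = deriv (\<lambda>z. deriv h z * v) z * v + cnj (deriv (\<lambda>z. deriv g z * v) z * v)"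
      by (rule pd_add_cnj[OF _ _ U z]) (intro holomorphic_intros h g U)+
    also have "deriv (\<lambda>z. deriv h z * v) z = deriv (deriv h) z * v"
      using holomorphic_deriv[OF h U] z U by (intro deriv_cmult_right) (auto simp: holomorphic_on_open field_differentiable_def)
    also have "deriv (\<lambda>z. deriv g z * v) z = deriv (deriv g) z * v"
      using holomorphic_deriv[OF g U] z U by (intro deriv_cmult_right) (auto simp: holomorphic_on_open field_differentiable_def)
    finally show ?thesis .
  qed
  show ?thesis
    unfolding harmonic_on_def by (intro conjI ballI Ck_on_add_cnj h g U) (simp add: twice mult.assoc)
qed

lemma dz_add_cnj:
  assumes "h holomorphic_on U" "g holomorphic_on U" "open U" "z \<in> U"
  shows "dz (\<lambda>z. h z + cnj (g z)) z = deriv h z"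
    and "dzbar (\<lambda>z. h z + cnj (g z)) z = cnj (deriv g z)"
  by (simp_all add: dz_def dzbar_def pd_add_cnj[OF assms] algebra_simps)

section \<open>Weak derivatives of continuously differentiable functions\<close>

lemma
  fixes f :: "complex \<Rightarrow> complex"
  assumes K: "compact K" and cont: "continuous_on U f" and supp: "\<And>z. z \<notin> K \<Longrightarrow> f z = 0" and KU: "K \<subseteq> U"
  shows integrable_lborel_if_compact_support: "integrable lborel f"
    and borel_measurable_if_compact_support: "f \<in> borel_measurable borel"
proof -
  have eq: "(\<lambda>z. indicator K z *\<^sub>R f z) = f" using supp by (auto simp: indicator_def)
  have "continuous_on K f" using cont KU by (rule continuous_on_subset)
  from borel_integrable_compact[OF K this] show "integrable lborel f" by (simp add: eq)
  from borel_measurable_integrable[OF this] show "f \<in> borel_measurable borel" by simp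
qed

text \<open>The integral of a difference quotient of \<open>f\<close> in direction \<open>v\<close> vanishes because Lebesgue measure is
invariant under translations. The quotients for the steps \<open>1 / (n + 1)\<close> are bounded by the
supremum of the directional derivative and live in one fixed disc, so dominated convergence transfers this to
the derivative.\<close>

lemma integral_pd_eq_0_if_compact_support:
  fixes f :: "complex \<Rightarrow> complex"
  assumes diff: "\<And>z. f differentiable (at z)" and cont: "continuous_on UNIV (pd v f)"
    and K: "compact K" and supp: "\<And>z. z \<notin> K \<Longrightarrow> f z = 0"
  shows "integral\<^sup>L lborel (pd v f) = 0"
proof -
  have contf: "continuous_on UNIV f"
    using diff by (simp add: continuous_at_imp_continuous_on differentiable_imp_continuous_within)
  have intf: "integrable lborel f"
    by (rule integrable_lborel_if_compact_support[OF K contf supp]) auto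
  have supp': "pd v f z = 0" if "z \<notin> K" for z
  proof -
    have "pd v f z = pd v (\<lambda>_. 0) z"
      by (rule pd_cong[of "- K"]) (use K that supp in \<open>auto intro: compact_imp_closed\<close>)
    thus ?thesis by (simp add: pd_def)
  qed
  obtain R where R: "\<And>z. z \<in> K \<Longrightarrow> cmod z \<le> R"
    using compact_imp_bounded[OF K] by (auto simp: bounded_iff)
  have "bounded (pd v f ` K)"
    by (intro compact_imp_bounded compact_continuous_image K continuous_on_subset[OF cont]) auto
  then obtain B0 where B0: "\<And>z. z \<in> K \<Longrightarrow> cmod (pd v f z) \<le> B0"
    by (auto simp: bounded_iff)
  define B where "B = max B0 0"
  have B: "cmod (pd v f z) \<le> B" "B \<ge> 0" for z
    using B0[of z] supp'[of z] by (cases "z \<in> K"; simp add: B_def le_max_iff_disj)+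
  have line: "((\<lambda>s. f (z + of_real s * v)) has_derivative (\<lambda>h. h *\<^sub>R pd v f (z + of_real s * v))) (at s within S)" for z s S
  proof -
    have D: "(f has_derivative frechet_derivative f (at w)) (at w)" for w
      using diff frechet_derivative_works by blast
    have "((\<lambda>s. z + of_real s * v) has_derivative (\<lambda>h. of_real h * v)) (at s within S)"
      by (auto intro!: derivative_eq_intros)
    from has_derivative_compose[OF this D]
    have "((\<lambda>s. f (z + of_real s * v)) has_derivative (\<lambda>h. frechet_derivative f (at (z + of_real s * v)) (of_real h * v))) (at s within S)" .
    moreover have "frechet_derivative f (at w) (of_real h * v) = h *\<^sub>R pd v f w" for h w
      using linear_frechet_derivative[OF diff, of w] unfolding pd_def
      by (metis linear_cmul scaleR_conv_of_real)
    ultimately show ?thesis by simp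
  qed
  define D where "D n z = real (Suc n) *\<^sub>R (f (z + of_real (inverse (real (Suc n))) * v) - f z)" for n z
  have D_le: "cmod (D n z) \<le> B" for n z
  proof -
    have "cmod (f (z + of_real (inverse (real (Suc n))) * v) - f (z + of_real 0 * v)) \<le> B * norm (inverse (real (Suc n)) - 0)"
    proof (rule differentiable_bound[OF convex_UNIV line])
      fix s :: real
      show "onorm (\<lambda>h. h *\<^sub>R pd v f (z + of_real s * v)) \<le> B"
        by (rule onorm_bound) (use B in \<open>auto simp: mult.commute[of B] intro!: mult_left_mono\<close>)
    qed auto
    hence "real (Suc n) * cmod (f (z + of_real (inverse (real (Suc n))) * v) - f z) \<le> real (Suc n) * (B * inverse (real (Suc n)))"
      by (intro mult_left_mono) simp_all
    also have "\<dots> = B" by (simp del: of_nat_Suc)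
    finally show ?thesis unfolding D_def by simp
  qed
  have D_int0: "integral\<^sup>L lborel (D n) = 0" and D_int: "integrable lborel (D n)" for n
  proof -
    define t where "t = of_real (inverse (real (Suc n))) * v"
    have m: "f \<in> borel_measurable borel" using borel_measurable_integrable[OF intf] by simp
    have i: "integrable lborel (\<lambda>z. f (t + z))"
      using intf m by (subst (asm) lborel_distr_plus[of t, symmetric]) (simp add: integrable_distr_eq)
    have e: "integral\<^sup>L lborel (\<lambda>z. f (t + z)) = integral\<^sup>L lborel f"
      using m by (subst (2) lborel_distr_plus[of t, symmetric]) (simp add: integral_distr)
    have D: "D n = (\<lambda>z. real (Suc n) *\<^sub>R (f (t + z) - f z))"
      by (simp add: D_def[abs_def] t_def add.commute)
    show "integrable lborel (D n)" unfolding D using i intf by simp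
    show "integral\<^sup>L lborel (D n) = 0" unfolding D using i intf e by (simp del: of_nat_Suc)
  qed
  \<comment> \<open>A step of length at most \<open>cmod v\<close> enlarges the disc that contains the support by at most \<open>cmod v\<close>.\<close>
  define w where "w z = B * indicator (cball 0 (R + cmod v)) z" for z :: complex
  have "(\<lambda>n. integral\<^sup>L lborel (D n)) \<longlonglongrightarrow> integral\<^sup>L lborel (pd v f)"
  proof (rule integral_dominated_convergence[where w = w])
    show "pd v f \<in> borel_measurable lborel"
      using borel_measurable_continuous_onI[OF cont] by simp
    show "D n \<in> borel_measurable lborel" for n
      using D_int by (rule borel_measurable_integrable)
    have "emeasure lborel (cball 0 (R + cmod v)) < \<infinity>"
      by (rule emeasure_bounded_finite) simp
    thus "integrable lborel w"
      unfolding w_def by (intro integrable_mult_right integrable_real_indicator) auto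
    show "AE z in lborel. (\<lambda>n. D n z) \<longlonglongrightarrow> pd v f z"
    proof (rule AE_I2)
      fix z
      have "((\<lambda>s. norm (f (z + of_real (0 + s) * v) - f (z + of_real 0 * v) - s *\<^sub>R pd v f (z + of_real 0 * v)) / norm s) \<longlongrightarrow> 0) (at 0)"
        using line[of z 0 UNIV] unfolding has_derivative_at by blast
      moreover have "eventually (\<lambda>s. norm (f (z + of_real (0 + s) * v) - f (z + of_real 0 * v) - s *\<^sub>R pd v f (z + of_real 0 * v)) / norm s
          = norm ((f (z + of_real s * v) - f z) /\<^sub>R s - pd v f z)) (at (0::real))"
      proof (rule eventually_at_filter[THEN iffD2], intro always_eventually allI impI)
        fix s :: real assume "s \<noteq> 0"
        hence "(f (z + of_real s * v) - f z) /\<^sub>R s - pd v f z = (f (z + of_real s * v) - f z - s *\<^sub>R pd v f z) /\<^sub>R s"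
          by (simp add: scaleR_diff_right)
        thus "norm (f (z + of_real (0 + s) * v) - f (z + of_real 0 * v) - s *\<^sub>R pd v f (z + of_real 0 * v)) / norm s
          = norm ((f (z + of_real s * v) - f z) /\<^sub>R s - pd v f z)"
          by (simp add: divide_inverse_commute)
      qed
      ultimately have "((\<lambda>s. norm ((f (z + of_real s * v) - f z) /\<^sub>R s - pd v f z)) \<longlongrightarrow> 0) (at 0)"
        by (rule Lim_transform_eventually)
      hence "((\<lambda>s. (f (z + of_real s * v) - f z) /\<^sub>R s) \<longlongrightarrow> pd v f z) (at 0)"
        by (subst Lim_null) (rule tendsto_norm_zero_cancel)
      moreover have "filterlim (\<lambda>n. inverse (real (Suc n))) (at 0) sequentially"
        unfolding filterlim_at using LIMSEQ_inverse_real_of_nat by auto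
      ultimately have "(\<lambda>n. (f (z + of_real (inverse (real (Suc n))) * v) - f z) /\<^sub>R inverse (real (Suc n))) \<longlonglongrightarrow> pd v f z"
        by (rule filterlim_compose)
      thus "(\<lambda>n. D n z) \<longlonglongrightarrow> pd v f z"
        unfolding D_def by (simp only: inverse_inverse_eq)
    qed
    show "AE z in lborel. cmod (D n z) \<le> w z" for n
    proof (rule AE_I2)
      fix z
      show "cmod (D n z) \<le> w z"
      proof (cases "z \<in> cball 0 (R + cmod v)")
        case True
        thus ?thesis using D_le by (simp add: w_def)
      next
        case False
        define t where "t = of_real (inverse (real (Suc n))) * v"
        have "inverse (real (Suc n)) * cmod v \<le> 1 * cmod v"
          by (intro mult_right_mono) (auto simp: inverse_le_1_iff)
        hence "cmod t \<le> cmod v"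
          unfolding t_def norm_mult norm_of_real by simp
        moreover have "cmod z > R + cmod v" using False by simp
        ultimately have "cmod (z + t) > R" "cmod z > R"
          using norm_diff_ineq[of z t] norm_ge_zero[of v] by linarith+
        hence "f (z + t) = 0" "f z = 0" using R[of "z + t"] R[of z] supp by fastforce+
        hence "D n z = 0" unfolding D_def t_def[symmetric] by simp
        thus ?thesis using B(2) by (simp add: w_def)
      qed
    qed
  qed
  thus ?thesis by (simp add: D_int0 LIMSEQ_const_iff)
qed

text \<open>Integration by parts: extended by zero, \<open>\<phi> f\<close> is continuously differentiable in direction \<open>v\<close> on the
whole plane and has compact support, so the integral of its derivative
\<open>(\<partial>\<^sub>v \<phi>) f + \<phi> \<partial>\<^sub>v f\<close> vanishes.\<close>

lemma weak_pd_if_classical: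
  assumes U: "open U" and diff: "\<And>z. z \<in> U \<Longrightarrow> f differentiable (at z)"
    and cont: "continuous_on U (pd v f)" and v: "v = 1 \<or> v = \<i>"
  shows "weak_pd U v f (pd v f)"
  unfolding weak_pd_def
proof (intro allI impI)
  fix \<phi> :: "complex \<Rightarrow> real" assume \<phi>: "test_function U \<phi>"
  define K where "K = closure {z. \<phi> z \<noteq> 0}"
  have K: "compact K" "K \<subseteq> U" using \<phi> by (auto simp: test_function_def K_def)
  have supp: "\<phi> z = 0" if "z \<notin> K" for z using that closure_subset[of "{z. \<phi> z \<noteq> 0}"] by (auto simp: K_def)
  have "Ck_on (Suc 0) UNIV \<phi>" using \<phi> unfolding test_function_def by blast
  hence \<phi>_diff: "\<phi> differentiable (at z)" and \<phi>_cont: "continuous_on UNIV (pd v \<phi>)" for z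
    using v by auto
  have \<phi>_cont0: "continuous_on S \<phi>" for S
    using \<phi>_diff by (simp add: continuous_at_imp_continuous_on differentiable_imp_continuous_within)
  have f_cont: "continuous_on U f"
    using diff by (simp add: continuous_at_imp_continuous_on differentiable_imp_continuous_within)
  have nK: "open (- K)" using K by (simp add: compact_imp_closed open_Compl)
  have supp': "pd v \<phi> z = 0" if "z \<notin> K" for z
  proof -
    have "pd v \<phi> z = pd v (\<lambda>_. 0) z"
      by (rule pd_cong[OF nK]) (use that supp in auto)
    thus ?thesis by (simp add: pd_def)
  qed
  define \<psi> where "\<psi> z = \<phi> z *\<^sub>R f z" for z
  define d where "d z = pd v \<phi> z *\<^sub>R f z + \<phi> z *\<^sub>R pd v f z" for z
  have \<psi>_der: "\<psi> differentiable (at z) \<and> pd v \<psi> z = d z" for z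
  proof (cases "z \<in> K")
    case True
    hence "z \<in> U" using K by auto
    have "(\<psi> has_derivative (\<lambda>h. \<phi> z *\<^sub>R frechet_derivative f (at z) h + frechet_derivative \<phi> (at z) h *\<^sub>R f z)) (at z)"
      unfolding \<psi>_def
      using \<phi>_diff diff[OF \<open>z \<in> U\<close>] by (intro has_derivative_scaleR) (simp_all flip: frechet_derivative_works)
    from this frechet_derivative_at[OF this] show ?thesis
      by (auto simp: differentiable_def pd_def d_def add.commute fun_eq_iff dest: sym)
  next
    case False
    have "\<psi> differentiable (at z) \<longleftrightarrow> (\<lambda>_. 0 :: complex) differentiable (at z)"
      by (rule differentiable_cong_open[OF nK]) (use False supp in \<open>auto simp: \<psi>_def\<close>)
    moreover have "pd v \<psi> z = pd v (\<lambda>_. 0) z"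
      by (rule pd_cong[OF nK]) (use False supp in \<open>auto simp: \<psi>_def\<close>)
    ultimately show ?thesis using supp supp' False by (simp add: pd_def d_def)
  qed
  \<comment> \<open>The plane is the union of two open sets: \<open>d\<close> is continuous on \<open>U\<close> and zero off the support of \<open>\<phi>\<close>.\<close>
  have d_cont: "continuous_on UNIV d"
  proof -
    have "continuous_on (- K) d \<longleftrightarrow> continuous_on (- K) (\<lambda>_. 0 :: complex)"
      by (rule continuous_on_cong) (auto simp: d_def supp supp')
    moreover have "continuous_on U d"
      unfolding d_def by (intro continuous_intros f_cont cont \<phi>_cont0 continuous_on_subset[OF \<phi>_cont]) auto
    ultimately have "continuous_on (U \<union> - K) d"
      by (intro continuous_on_open_Un U nK) auto
    moreover have "U \<union> - K = UNIV" using K by auto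
    ultimately show ?thesis by simp
  qed
  have pd_eq: "pd v \<psi> = d" using \<psi>_der by auto
  have "integral\<^sup>L lborel d = 0"
    unfolding pd_eq[symmetric]
    by (rule integral_pd_eq_0_if_compact_support[OF _ _ K(1)])
       (use \<psi>_der d_cont pd_eq supp in \<open>auto simp: \<psi>_def\<close>)
  have s1: "pd v \<phi> z *\<^sub>R f z = 0" and s2: "\<phi> z *\<^sub>R pd v f z = 0" if "z \<notin> K" for z
    using supp supp' that by auto
  have c1: "continuous_on U (\<lambda>z. pd v \<phi> z *\<^sub>R f z)" and c2: "continuous_on U (\<lambda>z. \<phi> z *\<^sub>R pd v f z)"
    by (intro continuous_intros f_cont cont \<phi>_cont0 continuous_on_subset[OF \<phi>_cont]; auto)+
  have to_lborel: "(LINT z:U|lebesgue. F z) = integral\<^sup>L lborel F"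
    if "continuous_on U F" "\<And>z. z \<notin> K \<Longrightarrow> F z = 0" for F :: "complex \<Rightarrow> complex"
  proof -
    have "indicator U z *\<^sub>R F z = F z" for z
      using that(2)[of z] K by (cases "z \<in> K") (auto simp: indicator_def)
    thus ?thesis
      unfolding set_lebesgue_integral_def
      using borel_measurable_if_compact_support[OF K(1) that K(2)] by (simp add: integral_completion)
  qed
  have "integral\<^sup>L lborel d = integral\<^sup>L lborel (\<lambda>z. pd v \<phi> z *\<^sub>R f z) + integral\<^sup>L lborel (\<lambda>z. \<phi> z *\<^sub>R pd v f z)"
    unfolding d_def
    by (intro Bochner_Integration.integral_add integrable_lborel_if_compact_support[OF K(1) c1 s1 K(2)]
          integrable_lborel_if_compact_support[OF K(1) c2 s2 K(2)])
  with \<open>integral\<^sup>L lborel d = 0\<close>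
  show "(LINT z:U|lebesgue. pd v \<phi> z *\<^sub>R f z) = - (LINT z:U|lebesgue. \<phi> z *\<^sub>R pd v f z)"
    using to_lborel[OF c1 s1] to_lborel[OF c2 s2] by (simp add: eq_neg_iff_add_eq_0)
qed

lemma L2_loc_if_continuous:
  assumes "open U" "continuous_on U f"
  shows "L2_loc U f"
  unfolding L2_loc_def
proof (intro conjI allI impI)
  show "set_borel_measurable lebesgue U f"
    unfolding set_borel_measurable_def
    using borel_measurable_continuous_on_indicator[of U f] assms by (intro measurable_completion) auto
next
  fix C assume C: "compact C \<and> C \<subseteq> U"
  hence "continuous_on C (\<lambda>z. (cmod (f z))\<^sup>2)"
    using assms by (intro continuous_intros) (auto intro: continuous_on_subset)
  from borel_integrable_compact[OF _ this] C
  show "set_integrable lebesgue C (\<lambda>z. (cmod (f z))\<^sup>2)"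
    unfolding set_integrable_def by (subst integrable_completion) auto
qed

lemma W12_loc_if_C1:
  assumes "open U" "Ck_on (Suc 0) U f"
  shows "W12_loc U f"
proof -
  have d: "\<And>z. z \<in> U \<Longrightarrow> f differentiable (at z)" and c: "continuous_on U (pd 1 f)" "continuous_on U (pd \<i> f)"
    using assms(2) by auto
  have "continuous_on U f"
    using d by (simp add: continuous_at_imp_continuous_on differentiable_imp_continuous_within)
  thus ?thesis
    unfolding W12_loc_def
    using L2_loc_if_continuous[OF assms(1)] c weak_pd_if_classical[OF assms(1) d] by blast
qed
section \<open>The inequality up to the radius\<close>

text \<open>The left side is the factor by which the coefficient estimates multiply \<open>1 - a\<^sub>0\<close> to bound both series.
The same equivalence therefore yields the inequality and its failure for the extremal map.\<close>

lemma affine_majorant_le_1_iff: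
  fixes K k r :: real
  assumes K: "K \<ge> 1" and k: "k = (K - 1) / (K + 1)" and r: "r < 1"
  shows "(1 + k) * (2 * (r / (1 - r))) \<le> 1 \<longleftrightarrow> r \<le> (K + 1) / (5 * K + 1)"
proof -
  have "1 + k = 2 * K / (K + 1)" using K by (simp add: k field_simps)
  hence "(1 + k) * (2 * (r / (1 - r))) = (4 * K * r) / ((K + 1) * (1 - r))" by simp
  also have "\<dots> \<le> 1 \<longleftrightarrow> 4 * K * r \<le> (K + 1) * (1 - r)"
    using K r by (intro divide_le_eq_1_pos) simp
  also have "\<dots> \<longleftrightarrow> r * (5 * K + 1) \<le> K + 1"
    by (simp add: algebra_simps)
  also have "\<dots> \<longleftrightarrow> r \<le> (K + 1) / (5 * K + 1)"
    using K by (simp add: pos_le_divide_eq)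
  finally show ?thesis .
qed

text \<open>Caratheodory's inequality for \<open>1 - h\<close> bounds every \<open>cmod (a n)\<close> with \<open>n > 0\<close> by
\<open>2 * (1 - a\<^sub>0)\<close>. Quasiconformality gives \<open>cmod g' \<le> k * cmod h'\<close>, so the series of \<open>g\<close> is at most \<open>k\<close>
times that of \<open>h\<close>; this comparison needs \<open>r \<le> 1 / 3\<close>, which holds because
\<open>(K + 1) / (5 * K + 1) \<le> 1 / 3\<close> is equivalent to \<open>K \<ge> 1\<close>.\<close>

lemma bohr_radius_bound:
  assumes K: "K \<ge> 1" and adm: "admissible K f h g a b"
    and r: "0 \<le> r" "r \<le> (K + 1) / (5 * K + 1)"
  shows "summable (\<lambda>n. cmod (a (Suc n)) * r ^ Suc n) \<and>
         summable (\<lambda>n. cmod (b (Suc n)) * r ^ Suc n) \<and>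
         Re (a 0) + (\<Sum>n. cmod (a (Suc n)) * r ^ Suc n)
                  + (\<Sum>n. cmod (b (Suc n)) * r ^ Suc n) \<le> 1"
proof -
  define k where "k = (K - 1) / (K + 1)"
  have h: "h holomorphic_on ball 0 1" and g: "g holomorphic_on ball 0 1"
    and f: "\<And>z. z \<in> ball 0 1 \<Longrightarrow> f z = h z + cnj (g z)"
    and ha: "\<And>z. z \<in> ball 0 1 \<Longrightarrow> (\<lambda>n. a n * z ^ n) sums h z"
    and gb: "\<And>z. z \<in> ball 0 1 \<Longrightarrow> (\<lambda>n. b (Suc n) * z ^ Suc n) sums g z"
    and Re_h: "\<And>z. z \<in> ball 0 1 \<Longrightarrow> Re (h z) \<le> 1" and h0: "h 0 = a 0"
    and qc: "quasiconformal_on K (ball 0 1) f"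
    using adm by (auto simp: admissible_def harmonic_series_def)
  have dz: "dz f z = deriv h z" "dzbar f z = cnj (deriv g z)" if z: "z \<in> ball 0 1" for z
  proof -
    have "pd v f z = pd v (\<lambda>z. h z + cnj (g z)) z" for v
      by (rule pd_cong[OF open_ball z f])
    thus "dz f z = deriv h z" "dzbar f z = cnj (deriv g z)"
      using dz_add_cnj[OF h g open_ball z] by (simp_all add: dz_def dzbar_def)
  qed
  have dil: "deriv h z \<noteq> 0 \<and> cmod (deriv g z) \<le> k * cmod (deriv h z)" if z: "z \<in> ball 0 1" for z
  proof -
    have "jacobian f z > 0" and ratio: "(cmod (dz f z) + cmod (dzbar f z)) / (cmod (dz f z) - cmod (dzbar f z)) \<le> K"
      using qc z by (auto simp: quasiconformal_on_def sense_preserving_on_def)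
    hence less: "cmod (deriv g z) < cmod (deriv h z)"
      unfolding jacobian_def dz[OF z] by (auto intro: power_less_imp_less_base)
    hence "cmod (deriv h z) + cmod (deriv g z) \<le> K * (cmod (deriv h z) - cmod (deriv g z))"
      using ratio unfolding dz[OF z] by (simp add: pos_divide_le_eq)
    hence "cmod (deriv g z) * (K + 1) \<le> (K - 1) * cmod (deriv h z)"
      by (simp add: algebra_simps)
    hence "cmod (deriv g z) \<le> k * cmod (deriv h z)"
      using K by (simp add: k_def field_simps)
    thus ?thesis using less by auto
  qed
  have H: "h has_fps_expansion Abs_fps a"
    using ha by (rule has_fps_expansion_if_sums)
  define b' where "b' n = (if n = 0 then 0 else b n)" for n
  have G: "g has_fps_expansion Abs_fps b'"
  proof (rule has_fps_expansion_if_sums)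
    fix z :: complex assume "z \<in> ball 0 1"
    thus "(\<lambda>n. b' n * z ^ n) sums g z"
      using sums_Suc[of "\<lambda>n. b' n * z ^ n" "g z"] gb[of z] by (simp add: b'_def)
  qed
  have a_le: "cmod (a n) \<le> 2 * (1 - Re (a 0))" if "n > 0" for n
  proof -
    have "(\<lambda>z. 1 - h z) has_fps_expansion (1 - Abs_fps a)"
      by (intro fps_expansion_intros H)
    hence "cmod (fps_nth (1 - Abs_fps a) n) \<le> 2 * Re (fps_nth (1 - Abs_fps a) 0)"
      using Re_h that by (intro norm_coeff_le_if_Re_nonneg[where F = "\<lambda>z. 1 - h z"] holomorphic_intros h) auto
    thus ?thesis using that by simp
  qed
  have "(K + 1) / (5 * K + 1) \<le> 1 / 3" using K by (simp add: field_simps)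
  hence r3: "r \<le> 1 / 3" using r by linarith
  have sum_a: "summable (\<lambda>n. cmod (a (Suc n)) * r ^ Suc n)"
    "(\<Sum>n. cmod (a (Suc n)) * r ^ Suc n) \<le> 2 * (1 - Re (a 0)) * (r / (1 - r))"
    using geometric_tail_majorant[of a, OF a_le r(1)] r3 by auto
  have sum_b: "summable (\<lambda>n. cmod (b (Suc n)) * r ^ Suc n)"
    "(\<Sum>n. cmod (b (Suc n)) * r ^ Suc n) \<le> k * (\<Sum>n. cmod (a (Suc n)) * r ^ Suc n)"
    using majorant_le_if_deriv_dominated[OF h g _ _ H G r(1) r3, of k] dil sum_a(1) by (auto simp: b'_def)
  have "(1 + k) * (2 * (r / (1 - r))) \<le> 1"
    using affine_majorant_le_1_iff[OF K k_def] r r3 by simp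
  moreover have "1 - Re (a 0) \<ge> 0" using Re_h[of 0] h0 by simp
  ultimately have "(1 - Re (a 0)) * ((1 + k) * (2 * (r / (1 - r)))) \<le> (1 - Re (a 0)) * 1"
    by (rule mult_left_mono)
  hence bound: "(1 + k) * (2 * (1 - Re (a 0)) * (r / (1 - r))) \<le> 1 - Re (a 0)"
    by (simp only: mult_ac mult_1_left)
  have "(\<Sum>n. cmod (a (Suc n)) * r ^ Suc n) + (\<Sum>n. cmod (b (Suc n)) * r ^ Suc n)
      \<le> (1 + k) * (\<Sum>n. cmod (a (Suc n)) * r ^ Suc n)"
    using sum_b(2) by (simp add: distrib_right)
  also have "\<dots> \<le> (1 + k) * (2 * (1 - Re (a 0)) * (r / (1 - r)))"
    using sum_a(2) K by (intro mult_left_mono) (auto simp: k_def)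
  also note bound
  finally show ?thesis
    using sum_a(1) sum_b(1) by (simp add: add.assoc)
qed

section \<open>The extremal mapping\<close>

text \<open>The left side says that \<open>w\<close> is nearer to 0 than to \<open>-1\<close>, and that \<open>w / (1 + w)\<close> lies in the unit disc.
This identifies the half plane onto which the inverse \<open>z \<mapsto> z / (1 - z)\<close> maps the disc.\<close>

lemma norm_less_norm_one_plus_iff: "cmod w < cmod (1 + w) \<longleftrightarrow> Re w > - 1 / 2"
proof -
  have "cmod w < cmod (1 + w) \<longleftrightarrow> (cmod w)\<^sup>2 < (cmod (1 + w))\<^sup>2"
    by (simp flip: not_le)
  also have "\<dots> \<longleftrightarrow> Re w > - 1 / 2"
    unfolding cmod_power2 by (simp add: power2_eq_square algebra_simps) linarith
  finally show ?thesis .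
qed

lemma Re_half_plane_map:
  assumes "z \<in> ball 0 1"
  shows "Re (z / (1 - z)) > - 1 / 2"
proof -
  have "z \<noteq> 1" using assms by auto
  hence "1 + z / (1 - z) = 1 / (1 - z)" by (simp add: field_simps)
  moreover have "cmod (z / (1 - z)) < cmod (1 / (1 - z))"
    using assms \<open>z \<noteq> 1\<close> by (simp add: norm_divide divide_strict_right_mono)
  ultimately show ?thesis by (metis norm_less_norm_one_plus_iff)
qed

text \<open>With \<open>q = z / (1 - z)\<close>, a conformal map onto a half plane, this is \<open>1 / 2 - q - k * cnj q\<close>: a conformal
map followed by an affine stretching, whose dilatation has the constant value \<open>k\<close>. The formula is
kept in the form \<open>h + cnj g\<close>.\<close>

definition affine_half_plane_map :: "real \<Rightarrow> complex \<Rightarrow> complex" where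
  "affine_half_plane_map k z = (1 / 2 - z / (1 - z)) + cnj (- of_real k * (z / (1 - z)))"

text \<open>The affine part scales the real part of \<open>q\<close> by \<open>-(1 + k)\<close> and the imaginary part by \<open>-(1 - k)\<close>; the
map \<open>T\<close> below undoes this, and \<open>w \<mapsto> w / (1 + w)\<close> then returns to the disc.\<close>

lemma homeomorphism_affine_half_plane_map:
  assumes k: "0 \<le> k" "k < 1"
  shows "\<exists>f'. homeomorphism (ball 0 1) {w. Re w < 1 + k / 2} (affine_half_plane_map k) f'"
proof -
  define T where "T w = Complex ((1 / 2 - Re w) / (1 + k)) (- Im w / (1 - k))" for w
  have f_T: "1 / 2 - T w - of_real k * cnj (T w) = w" for w
  proof (rule complex_eqI)
    have "(1 + k) * Re (T w) = 1 / 2 - Re w" "(1 - k) * Im (T w) = - Im w"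
      using k by (simp_all add: T_def)
    thus "Re (1 / 2 - T w - of_real k * cnj (T w)) = Re w"
      and "Im (1 / 2 - T w - of_real k * cnj (T w)) = Im w"
      by (simp_all add: algebra_simps)
  qed
  have T_f: "T (affine_half_plane_map k z) = z / (1 - z)" for z
  proof -
    have "T (1 / 2 - q - of_real k * cnj q) = q" for q
    proof (rule complex_eqI)
      have "1 / 2 - Re (1 / 2 - q - of_real k * cnj q) = (1 + k) * Re q"
        and "- Im (1 / 2 - q - of_real k * cnj q) = (1 - k) * Im q"
        by (simp_all add: algebra_simps)
      thus "Re (T (1 / 2 - q - of_real k * cnj q)) = Re q"
        and "Im (T (1 / 2 - q - of_real k * cnj q)) = Im q"
        unfolding T_def complex.sel using k by simp_all
    qed
    from this[of "z / (1 - z)"] show ?thesis by (simp add: affine_half_plane_map_def)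
  qed
  have Re_T: "Re (T w) > - 1 / 2" if "Re w < 1 + k / 2" for w
    using that k by (simp add: T_def field_simps)
  have nz: "1 + T w \<noteq> 0" if "Re w < 1 + k / 2" for w
  proof
    assume "1 + T w = 0"
    hence "T w = - 1" by (simp add: eq_neg_iff_add_eq_0 add.commute)
    thus False using Re_T[OF that] by simp
  qed
  have "homeomorphism (ball 0 1) {w. Re w < 1 + k / 2} (affine_half_plane_map k) (\<lambda>w. T w / (1 + T w))"
  proof (rule homeomorphismI)
    show "continuous_on (ball 0 1) (affine_half_plane_map k)"
      unfolding affine_half_plane_map_def by (intro continuous_intros) auto
    have "continuous_on A T" for A
      unfolding T_def Complex_eq using k by (intro continuous_intros) auto
    thus "continuous_on {w. Re w < 1 + k / 2} (\<lambda>w. T w / (1 + T w))"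
      using nz by (intro continuous_intros) auto
    show "affine_half_plane_map k ` ball 0 1 \<subseteq> {w. Re w < 1 + k / 2}"
    proof safe
      fix z :: complex assume "z \<in> ball 0 1"
      hence "(1 + k) * Re (z / (1 - z)) > (1 + k) * (- 1 / 2)"
        using Re_half_plane_map[of z] k by (intro mult_strict_left_mono) auto
      moreover have "Re (1 / 2 - q + cnj (- of_real k * q)) = 1 / 2 - (1 + k) * Re q" for q
        by (simp add: algebra_simps)
      hence "Re (affine_half_plane_map k z) = 1 / 2 - (1 + k) * Re (z / (1 - z))"
        unfolding affine_half_plane_map_def by blast
      ultimately show "Re (affine_half_plane_map k z) < 1 + k / 2" by (simp add: field_simps)
    qed
    show "(\<lambda>w. T w / (1 + T w)) ` {w. Re w < 1 + k / 2} \<subseteq> ball 0 1"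
    proof safe
      fix w assume w: "Re w < 1 + k / 2"
      have "cmod (T w) < cmod (1 + T w)"
        using Re_T[OF w] norm_less_norm_one_plus_iff by blast
      moreover have "cmod (1 + T w) > 0" using nz[OF w] by simp
      ultimately show "T w / (1 + T w) \<in> ball 0 1"
        by (simp add: norm_divide divide_less_eq)
    qed
    fix z :: complex assume "z \<in> ball 0 1"
    hence "z \<noteq> 1" by auto
    thus "T (affine_half_plane_map k z) / (1 + T (affine_half_plane_map k z)) = z"
      unfolding T_f by (simp add: field_simps)
  next
    fix w assume "w \<in> {w. Re w < 1 + k / 2}"
    hence "1 + T w \<noteq> 0" using nz by auto
    hence "(T w / (1 + T w)) / (1 - T w / (1 + T w)) = T w" by (simp add: field_simps)
    thus "affine_half_plane_map k (T w / (1 + T w)) = w"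
      using f_T[of w] by (simp add: affine_half_plane_map_def)
  qed
  thus ?thesis by blast
qed

text \<open>The moduli of the two Wirtinger derivatives are \<open>m\<close> and \<open>k * m\<close> with \<open>m = 1 / (cmod (1 - z))\<^sup>2\<close>, so the
distortion is \<open>(1 + k) / (1 - k) = K\<close> at every point.\<close>

lemma admissible_affine_half_plane_map:
  assumes K: "K \<ge> 1" and k: "k = (K - 1) / (K + 1)"
  shows "admissible K (affine_half_plane_map k) (\<lambda>z. 1 / 2 - z / (1 - z)) (\<lambda>z. - of_real k * (z / (1 - z)))
           (\<lambda>n. if n = 0 then 1 / 2 else - 1) (\<lambda>_. - of_real k)"
proof -
  have k01: "0 \<le> k" "k < 1" and K_eq: "(1 + k) / (1 - k) = K"
    using K by (simp_all add: k field_simps)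
  define h where "h z = 1 / 2 - z / (1 - z)" for z :: complex
  define g where "g z = - of_real k * (z / (1 - z))" for z :: complex
  have f: "affine_half_plane_map k = (\<lambda>z. h z + cnj (g z))"
    by (simp add: affine_half_plane_map_def[abs_def] h_def g_def)
  have h: "h holomorphic_on ball 0 1" and g: "g holomorphic_on ball 0 1"
    unfolding h_def g_def by (intro holomorphic_intros; force)+
  have q: "(\<lambda>n. z ^ Suc n) sums (z / (1 - z))" if "z \<in> ball 0 1" for z :: complex
    using sums_mult[OF geometric_sums[of z], of z] that by simp
  have h_sums: "(\<lambda>n. (if n = 0 then 1 / 2 else - 1) * z ^ n) sums h z" if "z \<in> ball 0 1" for z
    using sums_Suc[of "\<lambda>n. (if n = 0 then 1 / 2 else - 1) * z ^ n" "- (z / (1 - z))"] sums_minus[OF q[OF that]]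
    by (simp add: h_def)
  have g_sums: "(\<lambda>n. - of_real k * z ^ Suc n) sums g z" if "z \<in> ball 0 1" for z
    unfolding g_def by (rule sums_mult[OF q[OF that]])
  have deriv: "deriv h z = - 1 / (1 - z)\<^sup>2" "deriv g z = of_real k * (- 1 / (1 - z)\<^sup>2)" if "z \<in> ball 0 1" for z
  proof -
    have "1 - z \<noteq> 0" using that by auto
    hence q': "((\<lambda>z. z / (1 - z)) has_field_derivative 1 / (1 - z)\<^sup>2) (at z)"
      by (auto intro!: derivative_eq_intros simp: power2_eq_square)
    have "(h has_field_derivative - (1 / (1 - z)\<^sup>2)) (at z)"
      unfolding h_def using DERIV_diff[OF DERIV_const q'] by simp
    thus "deriv h z = - 1 / (1 - z)\<^sup>2" by (simp add: DERIV_imp_deriv)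
    have "(g has_field_derivative - of_real k * (1 / (1 - z)\<^sup>2)) (at z)"
      unfolding g_def by (rule DERIV_cmult[OF q'])
    thus "deriv g z = of_real k * (- 1 / (1 - z)\<^sup>2)" by (simp add: DERIV_imp_deriv)
  qed
  define m where "m z = 1 / (cmod (1 - z))\<^sup>2" for z
  have norms: "m z > 0" "cmod (dz (affine_half_plane_map k) z) = m z"
      "cmod (dzbar (affine_half_plane_map k) z) = k * m z" if "z \<in> ball 0 1" for z
    using that k01 unfolding f dz_add_cnj[OF h g open_ball that] complex_mod_cnj deriv[OF that] m_def
    by (auto simp: norm_mult norm_divide norm_power)
  have C1: "Ck_on (Suc 0) (ball 0 1) (affine_half_plane_map k)"
    unfolding f by (rule Ck_on_add_cnj[OF h g open_ball])
  have "sense_preserving_on (ball 0 1) (affine_half_plane_map k)"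
    unfolding sense_preserving_on_def
  proof (intro ballI conjI)
    fix z :: complex assume z: "z \<in> ball 0 1"
    show "affine_half_plane_map k differentiable at z" using C1 z by simp
    have "k\<^sup>2 < 1" using k01 by (simp add: power_less_one_iff)
    hence "k\<^sup>2 * (m z)\<^sup>2 < 1 * (m z)\<^sup>2" using norms(1)[OF z] by (intro mult_strict_right_mono) auto
    thus "jacobian (affine_half_plane_map k) z > 0"
      using norms[OF z] by (simp add: jacobian_def power_mult_distrib)
  qed
  moreover have "(m z + k * m z) / (m z - k * m z) \<le> K" if "z \<in> ball 0 1" for z
  proof -
    have "(m z + k * m z) / (m z - k * m z) = (m z * (1 + k)) / (m z * (1 - k))" by (simp add: algebra_simps)
    also have "\<dots> = K" using norms(1)[OF that] K_eq by simp
    finally show ?thesis by simp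
  qed
  moreover have "\<exists>\<Omega> f'. open \<Omega> \<and> connected \<Omega> \<and> homeomorphism (ball 0 1) \<Omega> (affine_half_plane_map k) f'"
    using homeomorphism_affine_half_plane_map[OF k01] open_halfspace_Re_lt[of "1 + k / 2"]
      convex_connected[OF convex_halfspace_Re_lt[of "1 + k / 2"]] by blast
  ultimately have "quasiconformal_on K (ball 0 1) (affine_half_plane_map k)"
    unfolding quasiconformal_on_def
    using W12_loc_if_C1[OF open_ball C1] norms(2,3) by simp
  moreover have "harmonic_series (affine_half_plane_map k) h g (\<lambda>n. if n = 0 then 1 / 2 else - 1) (\<lambda>_. - of_real k)"
    unfolding harmonic_series_def
    using harmonic_on_add_cnj[OF h g open_ball] h g h_sums g_sums by (simp add: f)
  moreover have "Re (h z) \<le> 1" if "z \<in> ball 0 1" for z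
    using Re_half_plane_map[OF that] by (simp add: h_def del: Re_divide)
  ultimately have "admissible K (affine_half_plane_map k) h g (\<lambda>n. if n = 0 then 1 / 2 else - 1) (\<lambda>_. - of_real k)"
    unfolding admissible_def by (simp add: h_def)
  thus ?thesis by (simp add: h_def[abs_def] g_def[abs_def])
qed

text \<open>The extremal map attains equality in every estimate used for the inequality: its coefficients of
positive index have moduli \<open>2 * (1 - a\<^sub>0) = 1\<close> and \<open>k\<close>.\<close>

lemma bohr_radius_sharp:
  assumes K: "K \<ge> 1" and r: "(K + 1) / (5 * K + 1) < r" "r < 1"
  shows "\<exists>f h g a b. admissible K f h g a b \<and>
               summable (\<lambda>n. cmod (a (Suc n)) * r ^ Suc n) \<and>
               summable (\<lambda>n. cmod (b (Suc n)) * r ^ Suc n) \<and>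
               Re (a 0) + (\<Sum>n. cmod (a (Suc n)) * r ^ Suc n)
                        + (\<Sum>n. cmod (b (Suc n)) * r ^ Suc n) > 1"
proof -
  define k where "k = (K - 1) / (K + 1)"
  define a :: "nat \<Rightarrow> complex" where "a n = (if n = 0 then 1 / 2 else - 1)" for n
  define b :: "nat \<Rightarrow> complex" where "b n = - of_real k" for n
  have k: "k \<ge> 0" using K by (simp add: k_def)
  have "(K + 1) / (5 * K + 1) > 0" using K by simp
  hence r0: "r > 0" using r by linarith
  define q where "q = r / (1 - r)"
  have geo: "(\<lambda>n. r ^ Suc n) sums q"
    using sums_mult[OF geometric_sums[of r], of r] r0 r by (simp add: q_def)
  have sum_a: "(\<lambda>n. cmod (a (Suc n)) * r ^ Suc n) sums q"
    using geo by (simp add: a_def)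
  have sum_b: "(\<lambda>n. cmod (b (Suc n)) * r ^ Suc n) sums (k * q)"
    using sums_mult[OF geo, of k] k by (simp add: b_def)
  have "(1 + k) * (2 * q) > 1"
    using affine_majorant_le_1_iff[OF K k_def r(2)] r(1) unfolding q_def by linarith
  hence gt_1: "Re (a 0) + (\<Sum>n. cmod (a (Suc n)) * r ^ Suc n) + (\<Sum>n. cmod (b (Suc n)) * r ^ Suc n) > 1"
    unfolding sums_unique[OF sum_a, symmetric] sums_unique[OF sum_b, symmetric]
    by (simp add: a_def algebra_simps)
  have adm: "admissible K (affine_half_plane_map k) (\<lambda>z. 1 / 2 - z / (1 - z)) (\<lambda>z. - of_real k * (z / (1 - z))) a b"
    using admissible_affine_half_plane_map[OF K k_def] by (simp add: a_def[abs_def] b_def[abs_def])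
  show ?thesis
    by (intro exI conjI) (rule adm sums_summable[OF sum_a] sums_summable[OF sum_b] gt_1)+
qed

section \<open>The Bohr radius\<close>

theorem theorem3:
  fixes K :: real
  assumes "K \<ge> 1"
  shows "(\<forall>f h g a b. admissible K f h g a b \<longrightarrow>
            (\<forall>r. 0 \<le> r \<and> r \<le> (K + 1) / (5 * K + 1) \<longrightarrow>
               summable (\<lambda>n. cmod (a (Suc n)) * r ^ Suc n) \<and>
               summable (\<lambda>n. cmod (b (Suc n)) * r ^ Suc n) \<and>
               Re (a 0) + (\<Sum>n. cmod (a (Suc n)) * r ^ Suc n)
                        + (\<Sum>n. cmod (b (Suc n)) * r ^ Suc n) \<le> 1)) \<and>
         (\<forall>r. (K + 1) / (5 * K + 1) < r \<and> r < 1 \<longrightarrow>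
            (\<exists>f h g a b. admissible K f h g a b \<and>
               summable (\<lambda>n. cmod (a (Suc n)) * r ^ Suc n) \<and>
               summable (\<lambda>n. cmod (b (Suc n)) * r ^ Suc n) \<and>
               Re (a 0) + (\<Sum>n. cmod (a (Suc n)) * r ^ Suc n)
                        + (\<Sum>n. cmod (b (Suc n)) * r ^ Suc n) > 1))"

proof (intro conjI[of "\<forall>f. _ f"] allI impI)
  fix f h g a b and r :: real
  assume "admissible K f h g a b" "0 \<le> r \<and> r \<le> (K + 1) / (5 * K + 1)"
  thus "summable (\<lambda>n. cmod (a (Suc n)) * r ^ Suc n) \<and>
        summable (\<lambda>n. cmod (b (Suc n)) * r ^ Suc n) \<and>
        Re (a 0) + (\<Sum>n. cmod (a (Suc n)) * r ^ Suc n) + (\<Sum>n. cmod (b (Suc n)) * r ^ Suc n) \<le> 1"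
    using bohr_radius_bound[OF assms] by simp
next
  fix r :: real
  assume "(K + 1) / (5 * K + 1) < r \<and> r < 1"
  thus "\<exists>f h g a b. admissible K f h g a b \<and>
          summable (\<lambda>n. cmod (a (Suc n)) * r ^ Suc n) \<and>
          summable (\<lambda>n. cmod (b (Suc n)) * r ^ Suc n) \<and>
          Re (a 0) + (\<Sum>n. cmod (a (Suc n)) * r ^ Suc n) + (\<Sum>n. cmod (b (Suc n)) * r ^ Suc n) > 1"
    using bohr_radius_sharp[OF assms] by simp
qed

end
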